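(* If $R$ is an abelian, right nonsingular, right quasi-continuous ring, then $R$ is uniquely special almost clean.
   Context: Rings are associative with identity. A ring is abelian if all of its idempotents are central. A ring $R$ is right nonsingular if no nonzero element of $R$ has an essential right ideal as its right annihilator. $R$ is right quasi-continuous if the right module $M=R_R$ satisfies (C1) every submodule of $M$ is essential in a direct summand of $M$, and (C3) if $A$ and $B$ are direct summands of $M$ with $A\cap B=0$, then $A\oplus B$ is also a direct summand of $M$. An element of a ring is regular if it is neither a left nor a right zero-divisor. A special almost clean decomposition of $a\in R$ is an expression $a=u+e$ with $u$ a regular element, $e$ an idempotent, and $aR\cap eR=0$. $R$ is uniquely special almost clean if every element has exactly one special almost clean decomposition. *)

theory Defs
  imports "HOL-Algebra.Ideal"
begin

text \<open>
  The submodules of the right module \<open>R\<^sub>R\<close> are the right ideals of \<open>R\<close>, so the module-theoretic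
  notions below (essential submodule, direct summand, (C1), (C3)) are spelled out for right ideals.
\<close>

definition right_ideal :: "('a, 'b) ring_scheme \<Rightarrow> 'a set \<Rightarrow> bool" where
  "right_ideal R I \<longleftrightarrow>
     additive_subgroup I R \<and> (\<forall>x\<in>I. \<forall>r\<in>carrier R. x \<otimes>\<^bsub>R\<^esub> r \<in> I)"

definition principal_right_ideal :: "('a, 'b) ring_scheme \<Rightarrow> 'a \<Rightarrow> 'a set" where
  "principal_right_ideal R a = {a \<otimes>\<^bsub>R\<^esub> r | r. r \<in> carrier R}"

definition essential_in :: "('a, 'b) ring_scheme \<Rightarrow> 'a set \<Rightarrow> 'a set \<Rightarrow> bool" where
  "essential_in R N K \<longleftrightarrow>
     right_ideal R N \<and> right_ideal R K \<and> N \<subseteq> K \<and>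
     (\<forall>L. right_ideal R L \<and> L \<subseteq> K \<and> L \<noteq> {\<zero>\<^bsub>R\<^esub>} \<longrightarrow> N \<inter> L \<noteq> {\<zero>\<^bsub>R\<^esub>})"

definition direct_summand :: "('a, 'b) ring_scheme \<Rightarrow> 'a set \<Rightarrow> bool" where
  "direct_summand R A \<longleftrightarrow>
     right_ideal R A \<and>
     (\<exists>B. right_ideal R B \<and> A \<inter> B = {\<zero>\<^bsub>R\<^esub>} \<and> A <+>\<^bsub>R\<^esub> B = carrier R)"

definition condition_C1 :: "('a, 'b) ring_scheme \<Rightarrow> bool" where
  "condition_C1 R \<longleftrightarrow>
     (\<forall>N. right_ideal R N \<longrightarrow> (\<exists>D. direct_summand R D \<and> essential_in R N D))"

definition condition_C3 :: "('a, 'b) ring_scheme \<Rightarrow> bool" where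
  "condition_C3 R \<longleftrightarrow>
     (\<forall>A B. direct_summand R A \<and> direct_summand R B \<and> A \<inter> B = {\<zero>\<^bsub>R\<^esub>}
        \<longrightarrow> direct_summand R (A <+>\<^bsub>R\<^esub> B))"

definition right_quasi_continuous :: "('a, 'b) ring_scheme \<Rightarrow> bool" where
  "right_quasi_continuous R \<longleftrightarrow> condition_C1 R \<and> condition_C3 R"

definition right_annihilator :: "('a, 'b) ring_scheme \<Rightarrow> 'a \<Rightarrow> 'a set" where
  "right_annihilator R x = {r \<in> carrier R. x \<otimes>\<^bsub>R\<^esub> r = \<zero>\<^bsub>R\<^esub>}"

definition right_nonsingular :: "('a, 'b) ring_scheme \<Rightarrow> bool" where
  "right_nonsingular R \<longleftrightarrow>
     \<not> (\<exists>x\<in>carrier R. x \<noteq> \<zero>\<^bsub>R\<^esub> \<and> essential_in R (right_annihilator R x) (carrier R))"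

definition idempotent_element :: "('a, 'b) ring_scheme \<Rightarrow> 'a \<Rightarrow> bool" where
  "idempotent_element R e \<longleftrightarrow> e \<in> carrier R \<and> e \<otimes>\<^bsub>R\<^esub> e = e"

definition abelian_idempotent_ring :: "('a, 'b) ring_scheme \<Rightarrow> bool" where
  "abelian_idempotent_ring R \<longleftrightarrow>
     (\<forall>e. idempotent_element R e \<longrightarrow> (\<forall>r\<in>carrier R. e \<otimes>\<^bsub>R\<^esub> r = r \<otimes>\<^bsub>R\<^esub> e))"

text \<open>In a nonzero ring, \<open>\<zero>\<close> counts as a zero-divisor.\<close>

definition left_zero_divisor :: "('a, 'b) ring_scheme \<Rightarrow> 'a \<Rightarrow> bool" where
  "left_zero_divisor R a \<longleftrightarrow>
     a \<in> carrier R \<and> (\<exists>b\<in>carrier R. b \<noteq> \<zero>\<^bsub>R\<^esub> \<and> a \<otimes>\<^bsub>R\<^esub> b = \<zero>\<^bsub>R\<^esub>)"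

definition right_zero_divisor :: "('a, 'b) ring_scheme \<Rightarrow> 'a \<Rightarrow> bool" where
  "right_zero_divisor R a \<longleftrightarrow>
     a \<in> carrier R \<and> (\<exists>b\<in>carrier R. b \<noteq> \<zero>\<^bsub>R\<^esub> \<and> b \<otimes>\<^bsub>R\<^esub> a = \<zero>\<^bsub>R\<^esub>)"

definition regular_element :: "('a, 'b) ring_scheme \<Rightarrow> 'a \<Rightarrow> bool" where
  "regular_element R u \<longleftrightarrow>
     u \<in> carrier R \<and> \<not> left_zero_divisor R u \<and> \<not> right_zero_divisor R u"

definition special_almost_clean_decompositions ::
    "('a, 'b) ring_scheme \<Rightarrow> 'a \<Rightarrow> ('a \<times> 'a) set" where
  "special_almost_clean_decompositions R a =
     {(u, e). regular_element R u \<and> idempotent_element R e \<and> a = u \<oplus>\<^bsub>R\<^esub> e \<and>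
        principal_right_ideal R a \<inter> principal_right_ideal R e = {\<zero>\<^bsub>R\<^esub>}}"

definition uniquely_special_almost_clean :: "('a, 'b) ring_scheme \<Rightarrow> bool" where
  "uniquely_special_almost_clean R \<longleftrightarrow>
     (\<forall>a\<in>carrier R. \<exists>!d. d \<in> special_almost_clean_decompositions R a)"

end

theory Submission
  imports Defs
begin

text \<open>
  The right annihilator of an element \<open>a\<close> of \<open>R\<close> is a direct summand. By (C1) it is essential in
  some \<open>eR\<close>, where \<open>e\<close> is a central idempotent; since \<open>ae\<close> is annihilated both by this
  annihilator and by \<open>(1 - e)R\<close>, its right annihilator is essential in \<open>R\<close>, so that \<open>ae = 0\<close> by
  nonsingularity, and \<open>eR\<close> itself is the annihilator of \<open>a\<close>
  (\<open>right_annihilator_generated_by_idempotent\<close>).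

  Such a ring is reduced: if \<open>b\<^sup>2 = 0\<close>, then \<open>b\<close> lies in its own annihilator \<open>eR\<close>, hence
  \<open>b = eb = be = 0\<close>. So \<open>xa = 0\<close> forces \<open>ax = 0\<close>, which makes the situation left-right symmetric.

  The decomposition of \<open>a\<close> is then \<open>a = (a - e) + e\<close>. On the factor \<open>eR\<close> of the ring
  \<open>R = eR \<times> (1 - e)R\<close> the element \<open>a - e\<close> is \<open>-1\<close>, and on the factor \<open>(1 - e)R\<close> it is \<open>a\<close>, which
  has no annihilator left there. Conversely, if \<open>a = v + f\<close> is any special almost clean
  decomposition, then \<open>af = fa\<close> lies in \<open>aR \<inter> fR = 0\<close>, so \<open>f \<in> eR\<close>. Therefore
  \<open>v(e - f) = ae - af - fe + f = 0\<close>, and regularity of \<open>v\<close> gives \<open>f = e\<close>.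
\<close>

section \<open>Right ideals and direct summands\<close>

context ring
begin

lemma minus_eq_zeroD:
  assumes "x \<in> carrier R" "y \<in> carrier R" "x \<ominus> y = \<zero>"
  shows "x = y"
  using assms minus_equality[of x "\<ominus> y"] by (simp add: minus_eq)

lemma right_ideal_closed:
  assumes "right_ideal R I"
  shows "I \<subseteq> carrier R" "\<zero> \<in> I"
    "\<And>x y. x \<in> I \<Longrightarrow> y \<in> I \<Longrightarrow> x \<oplus> y \<in> I"
    "\<And>x. x \<in> I \<Longrightarrow> \<ominus> x \<in> I"
    "\<And>x r. x \<in> I \<Longrightarrow> r \<in> carrier R \<Longrightarrow> x \<otimes> r \<in> I"
proof -
  interpret additive_subgroup I R using assms by (simp add: right_ideal_def)
  show "I \<subseteq> carrier R" "\<zero> \<in> I" "\<And>x y. x \<in> I \<Longrightarrow> y \<in> I \<Longrightarrow> x \<oplus> y \<in> I"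
    using a_subset by auto
  show "\<And>x. x \<in> I \<Longrightarrow> \<ominus> x \<in> I" by simp
  show "\<And>x r. x \<in> I \<Longrightarrow> r \<in> carrier R \<Longrightarrow> x \<otimes> r \<in> I"
    using assms by (simp add: right_ideal_def)
qed

lemma right_idealI:
  assumes "I \<subseteq> carrier R" "\<zero> \<in> I"
    "\<And>x y. x \<in> I \<Longrightarrow> y \<in> I \<Longrightarrow> x \<oplus> y \<in> I"
    "\<And>x r. x \<in> I \<Longrightarrow> r \<in> carrier R \<Longrightarrow> x \<otimes> r \<in> I"
  shows "right_ideal R I"
proof -
  have "\<ominus> x \<in> I" if "x \<in> I" for x
  proof -
    have "x \<otimes> (\<ominus> \<one>) \<in> I" using assms(4) that by simp
    moreover have "x \<otimes> (\<ominus> \<one>) = \<ominus> x" using assms(1) that by (simp add: subset_iff r_minus)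
    ultimately show ?thesis by simp
  qed
  then have "subgroup I (add_monoid R)"
    using assms by (intro group.subgroupI[OF a_group]) (auto simp: a_inv_def)
  then show ?thesis
    using assms(4) by (simp add: right_ideal_def additive_subgroup_def)
qed

lemma right_ideal_carrier: "right_ideal R (carrier R)"
  by (rule right_idealI) auto

lemma right_ideal_Int:
  assumes "right_ideal R I" "right_ideal R J"
  shows "right_ideal R (I \<inter> J)"
  using right_ideal_closed[OF assms(1)] right_ideal_closed[OF assms(2)]
  by (intro right_idealI) auto

lemma right_ideal_right_annihilator:
  assumes "a \<in> carrier R"
  shows "right_ideal R (right_annihilator R a)"
  using assms
  by (intro right_idealI) (auto simp: right_annihilator_def r_distr m_assoc[symmetric])

text \<open>
  The component of \<open>\<one>\<close> in \<open>D\<close> is a left unit for \<open>D\<close>: for \<open>d \<in> D\<close>, the difference \<open>d - ed\<close> lies in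
  \<open>D\<close> and in the complement.
\<close>

lemma direct_summand_idempotent:
  assumes "direct_summand R D"
  obtains e where "idempotent_element R e" "e \<in> D" "\<And>d. d \<in> D \<Longrightarrow> e \<otimes> d = d"
proof -
  from assms obtain B where D: "right_ideal R D" and B: "right_ideal R B"
    and DB: "D \<inter> B = {\<zero>}" "D <+> B = carrier R"
    unfolding direct_summand_def by blast
  note D_closed = right_ideal_closed[OF D] and B_closed = right_ideal_closed[OF B]
  have "\<one> \<in> D <+> B" using DB by simp
  then obtain e f where e: "e \<in> D" and f: "f \<in> B" and one: "\<one> = e \<oplus> f"
    unfolding set_add_def' by blast
  have ef: "e \<in> carrier R" "f \<in> carrier R" using e f D_closed(1) B_closed(1) by auto
  have id: "e \<otimes> d = d" if d: "d \<in> D" for d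
  proof -
    have dR: "d \<in> carrier R" using d D_closed(1) by auto
    have split: "d = e \<otimes> d \<oplus> f \<otimes> d"
      using one ef dR by (metis l_distr l_one)
    have "f \<otimes> d = \<ominus> (e \<otimes> d) \<oplus> d"
      using split ef dR by (metis m_closed r_neg1)
    also have "\<dots> \<in> D" using D_closed e d dR by simp
    finally have "f \<otimes> d \<in> D \<inter> B" using B_closed f dR by simp
    then have "f \<otimes> d = \<zero>" using DB by simp
    then show ?thesis using split ef dR by simp
  qed
  with e ef show ?thesis by (intro that[of e]) (auto simp: idempotent_element_def)
qed

section \<open>Annihilators in abelian right nonsingular rings with (C1)\<close>

text \<open>
  A right ideal \<open>L\<close> either meets \<open>eR\<close> nontrivially, and then meets the essential submodule
  \<open>ann(a)\<close> of \<open>eR\<close>, or satisfies \<open>Le = 0\<close> and is itself contained in \<open>ann(ae)\<close>.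
\<close>

lemma essential_right_annihilator_mult_idempotent:
  assumes a: "a \<in> carrier R"
    and e: "e \<in> carrier R" "e \<in> D"
    and central: "\<And>r. r \<in> carrier R \<Longrightarrow> e \<otimes> r = r \<otimes> e"
    and left_unit: "\<And>d. d \<in> D \<Longrightarrow> e \<otimes> d = d"
    and ess: "essential_in R (right_annihilator R a) D"
  shows "essential_in R (right_annihilator R (a \<otimes> e)) (carrier R)"
  unfolding essential_in_def
proof (intro conjI allI impI)
  show "right_ideal R (right_annihilator R (a \<otimes> e))"
    using a e by (intro right_ideal_right_annihilator) simp
  show "right_ideal R (carrier R)" by (rule right_ideal_carrier)
  show "right_annihilator R (a \<otimes> e) \<subseteq> carrier R" by (auto simp: right_annihilator_def)
next
  fix L assume L: "right_ideal R L \<and> L \<subseteq> carrier R \<and> L \<noteq> {\<zero>}"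
  then have L_ideal: "right_ideal R L" and L_sub: "L \<subseteq> carrier R" by auto
  have D: "right_ideal R D" using ess by (simp add: essential_in_def)
  have ann_sub: "right_annihilator R a \<inter> D \<subseteq> right_annihilator R (a \<otimes> e)"
    using a e left_unit by (auto simp: right_annihilator_def m_assoc)
  show "right_annihilator R (a \<otimes> e) \<inter> L \<noteq> {\<zero>}"
  proof (cases "L \<inter> D = {\<zero>}")
    case True
    have "x \<in> right_annihilator R (a \<otimes> e)" if x: "x \<in> L" for x
    proof -
      have xR: "x \<in> carrier R" using x L_sub by auto
      have "x \<otimes> e \<in> L" using right_ideal_closed[OF L_ideal] x e by simp
      moreover have "x \<otimes> e \<in> D"
        using right_ideal_closed[OF D] xR e central[OF xR] by metis
      ultimately have "x \<otimes> e = \<zero>" using True by blast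
      then show ?thesis
        using xR a e central[OF xR] by (simp add: right_annihilator_def m_assoc)
    qed
    then show ?thesis using L by (metis Int_absorb1 subsetI)
  next
    case False
    then have "right_annihilator R a \<inter> (L \<inter> D) \<noteq> {\<zero>}"
      using ess right_ideal_Int[OF L_ideal D] by (auto simp: essential_in_def)
    moreover have "\<zero> \<in> right_annihilator R a \<inter> (L \<inter> D)"
      using right_ideal_closed(2)[OF L_ideal] right_ideal_closed(2)[OF D] a
      by (simp add: right_annihilator_def)
    ultimately show ?thesis using ann_sub by blast
  qed
qed

text \<open>
  Nonsingularity upgrades the essential inclusion of \<open>ann(a)\<close> in \<open>eR\<close> to an equality, since the
  element \<open>ae\<close> that measures the gap between the two has an essential annihilator.
\<close>

lemma right_annihilator_generated_by_idempotent:
  assumes abelian: "abelian_idempotent_ring R"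
    and nonsingular: "right_nonsingular R"
    and C1: "condition_C1 R"
    and a: "a \<in> carrier R"
  obtains e where "idempotent_element R e" "a \<otimes> e = \<zero>"
    "\<And>x. x \<in> carrier R \<Longrightarrow> a \<otimes> x = \<zero> \<Longrightarrow> e \<otimes> x = x"
proof -
  obtain D where D: "direct_summand R D" and ess: "essential_in R (right_annihilator R a) D"
    using C1 right_ideal_right_annihilator[OF a] unfolding condition_C1_def by blast
  obtain e where e: "idempotent_element R e" "e \<in> D"
    and left_unit: "\<And>d. d \<in> D \<Longrightarrow> e \<otimes> d = d"
    using direct_summand_idempotent[OF D] by blast
  have eR: "e \<in> carrier R" using e by (simp add: idempotent_element_def)
  have "essential_in R (right_annihilator R (a \<otimes> e)) (carrier R)"
    using abelian e eR left_unit ess a unfolding abelian_idempotent_ring_def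
    by (intro essential_right_annihilator_mult_idempotent) blast+
  then have "a \<otimes> e = \<zero>"
    using nonsingular a eR unfolding right_nonsingular_def by blast
  moreover have "e \<otimes> x = x" if "x \<in> carrier R" "a \<otimes> x = \<zero>" for x
    using that ess left_unit by (auto simp: essential_in_def right_annihilator_def)
  ultimately show ?thesis using e that by blast
qed

lemma square_zero_imp_zero:
  assumes "abelian_idempotent_ring R" "right_nonsingular R" "condition_C1 R"
    and b: "b \<in> carrier R" "b \<otimes> b = \<zero>"
  shows "b = \<zero>"
proof -
  obtain e where "idempotent_element R e" "b \<otimes> e = \<zero>" "e \<otimes> b = b"
    using right_annihilator_generated_by_idempotent[OF assms(1-3) b(1)] b by metis
  then show ?thesis
    using assms(1) b(1) by (metis abelian_idempotent_ring_def)
qed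

text \<open>
  The hypotheses control right annihilators only; this carries the control over to left annihilators,
  because \<open>(ax)\<^sup>2 = a(xa)x\<close>.
\<close>

lemma left_annihilated_imp_right_annihilated:
  assumes "abelian_idempotent_ring R" "right_nonsingular R" "condition_C1 R"
    and a: "a \<in> carrier R" and x: "x \<in> carrier R" and "x \<otimes> a = \<zero>"
  shows "a \<otimes> x = \<zero>"
proof (rule square_zero_imp_zero[OF assms(1-3)])
  have "(a \<otimes> x) \<otimes> (a \<otimes> x) = a \<otimes> (x \<otimes> a) \<otimes> x"
    using a x by (simp add: m_assoc)
  then show "(a \<otimes> x) \<otimes> (a \<otimes> x) = \<zero>" using assms by simp
qed (use a x in simp)

section \<open>Special almost clean decompositions\<close>

text \<open>
  Multiplying \<open>(a - e)x = 0\<close> by \<open>e\<close> gives \<open>ex = 0\<close>, hence \<open>ax = 0\<close>, hence \<open>x = ex = 0\<close>; the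
  second annihilator condition on \<open>e\<close> lets the same computation run on the other side.
\<close>

lemma regular_element_diff_idempotent:
  assumes e: "idempotent_element R e"
    and central: "\<And>r. r \<in> carrier R \<Longrightarrow> e \<otimes> r = r \<otimes> e"
    and a: "a \<in> carrier R" and ae: "a \<otimes> e = \<zero>"
    and right: "\<And>x. x \<in> carrier R \<Longrightarrow> a \<otimes> x = \<zero> \<Longrightarrow> e \<otimes> x = x"
    and left: "\<And>x. x \<in> carrier R \<Longrightarrow> x \<otimes> a = \<zero> \<Longrightarrow> e \<otimes> x = x"
  shows "regular_element R (a \<ominus> e)"
proof -
  have eR: "e \<in> carrier R" and ee: "e \<otimes> e = e" using e by (auto simp: idempotent_element_def)
  have ea: "e \<otimes> a = \<zero>" using central[OF a] ae by simp
  have "x = \<zero>" if x: "x \<in> carrier R" and 0: "(a \<ominus> e) \<otimes> x = \<zero>" for x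
  proof -
    have "a \<otimes> x \<ominus> e \<otimes> x = \<zero>" using 0 a eR x by (simp add: minus_eq l_distr l_minus)
    from minus_eq_zeroD[OF _ _ this] have eq: "a \<otimes> x = e \<otimes> x" using a eR x by blast
    have "e \<otimes> x = e \<otimes> (e \<otimes> x)" using eR x ee by (simp add: m_assoc[symmetric])
    also have "\<dots> = (e \<otimes> a) \<otimes> x" using eq a eR x by (simp add: m_assoc)
    also have "\<dots> = \<zero>" using ea x by simp
    finally have ex: "e \<otimes> x = \<zero>" .
    then show ?thesis using right[OF x] eq by simp
  qed
  moreover have "x = \<zero>" if x: "x \<in> carrier R" and 0: "x \<otimes> (a \<ominus> e) = \<zero>" for x
  proof -
    have "x \<otimes> a \<ominus> x \<otimes> e = \<zero>" using 0 a eR x by (simp add: minus_eq r_distr r_minus)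
    from minus_eq_zeroD[OF _ _ this] have eq: "x \<otimes> a = x \<otimes> e" using a eR x by blast
    have "x \<otimes> e = (x \<otimes> e) \<otimes> e" using eR x ee by (simp add: m_assoc)
    also have "\<dots> = x \<otimes> (a \<otimes> e)" using eq a eR x by (simp add: m_assoc[symmetric])
    also have "\<dots> = \<zero>" using ae x by simp
    finally have xe: "x \<otimes> e = \<zero>" .
    then show ?thesis using left[OF x] eq central[OF x] by simp
  qed
  ultimately show ?thesis
    using minus_closed[OF a eR]
    unfolding regular_element_def left_zero_divisor_def right_zero_divisor_def by blast
qed

lemma special_almost_clean_decomposition_diff_idempotent:
  assumes e: "idempotent_element R e"
    and central: "\<And>r. r \<in> carrier R \<Longrightarrow> e \<otimes> r = r \<otimes> e"
    and a: "a \<in> carrier R" and ae: "a \<otimes> e = \<zero>"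
    and reg: "regular_element R (a \<ominus> e)"
  shows "(a \<ominus> e, e) \<in> special_almost_clean_decompositions R a"
proof -
  have eR: "e \<in> carrier R" and ee: "e \<otimes> e = e" using e by (auto simp: idempotent_element_def)
  have "a \<otimes> r = \<zero>" if "r \<in> carrier R" "s \<in> carrier R" and eq: "a \<otimes> r = e \<otimes> s" for r s
  proof -
    have "e \<otimes> s = e \<otimes> (e \<otimes> s)" using eR that ee by (simp add: m_assoc[symmetric])
    also have "\<dots> = (e \<otimes> a) \<otimes> r" using eq[symmetric] a eR that by (simp add: m_assoc)
    also have "\<dots> = \<zero>" using central[OF a] ae that by simp
    finally show ?thesis using eq by simp
  qed
  moreover have "\<zero> = a \<otimes> \<zero>" "\<zero> = e \<otimes> \<zero>" using a eR by auto
  ultimately have "principal_right_ideal R a \<inter> principal_right_ideal R e = {\<zero>}"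
    unfolding principal_right_ideal_def by blast
  moreover have "a = (a \<ominus> e) \<oplus> e" using a eR by (simp add: minus_eq a_assoc l_neg)
  ultimately show ?thesis
    using e reg by (simp add: special_almost_clean_decompositions_def)
qed

text \<open>
  Disjointness of \<open>aR\<close> and \<open>fR\<close> forces \<open>f \<in> ann(a) = eR\<close>. If \<open>f\<close> were strictly smaller than \<open>e\<close>, then
  \<open>v = a - f\<close> would vanish on the factor \<open>(e - f)R\<close>.
\<close>

lemma special_almost_clean_decomposition_unique:
  assumes e: "idempotent_element R e"
    and central_e: "\<And>r. r \<in> carrier R \<Longrightarrow> e \<otimes> r = r \<otimes> e"
    and a: "a \<in> carrier R" and ae: "a \<otimes> e = \<zero>"
    and right: "\<And>x. x \<in> carrier R \<Longrightarrow> a \<otimes> x = \<zero> \<Longrightarrow> e \<otimes> x = x"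
    and central_f: "\<And>r. r \<in> carrier R \<Longrightarrow> f \<otimes> r = r \<otimes> f"
    and dec: "(v, f) \<in> special_almost_clean_decompositions R a"
  shows "(v, f) = (a \<ominus> e, e)"
proof -
  have eR: "e \<in> carrier R" using e by (simp add: idempotent_element_def)
  from dec have v: "regular_element R v" and f: "idempotent_element R f" and avf: "a = v \<oplus> f"
    and int: "principal_right_ideal R a \<inter> principal_right_ideal R f = {\<zero>}"
    by (auto simp: special_almost_clean_decompositions_def)
  have vR: "v \<in> carrier R" and fR: "f \<in> carrier R" and ff: "f \<otimes> f = f"
    using v f by (auto simp: regular_element_def idempotent_element_def)
  have "a \<otimes> f \<in> principal_right_ideal R a \<inter> principal_right_ideal R f"
    using a fR central_f[OF a, symmetric] unfolding principal_right_ideal_def by blast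
  then have af: "a \<otimes> f = \<zero>" using int by simp
  then have ef: "e \<otimes> f = f" using right fR by simp
  have veq: "v = a \<ominus> f" using avf vR fR by (simp add: minus_eq a_assoc r_neg)
  have "v \<otimes> e = a \<otimes> e \<ominus> f \<otimes> e"
    unfolding veq using a eR fR by (simp add: minus_eq l_distr l_minus)
  moreover have "v \<otimes> f = a \<otimes> f \<ominus> f \<otimes> f"
    unfolding veq using a fR by (simp add: minus_eq l_distr l_minus)
  ultimately have "v \<otimes> e = v \<otimes> f"
    using ae af ff ef central_e[OF fR] by simp
  then have "v \<otimes> (e \<ominus> f) = \<zero>"
    using vR eR fR by (simp add: minus_eq r_distr r_minus r_neg)
  then have "e \<ominus> f = \<zero>"
    using v vR eR fR unfolding regular_element_def left_zero_divisor_def by blast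
  from minus_eq_zeroD[OF eR fR this] have "f = e" by simp
  with veq show ?thesis by simp
qed

end

theorem corollary4p2:
  fixes R :: "('a, 'b) ring_scheme"
  assumes "ring R"
    and "abelian_idempotent_ring R"
    and "right_nonsingular R"
    and "right_quasi_continuous R"
  shows "uniquely_special_almost_clean R"
proof -
  interpret ring R by (rule assms)
  note abelian = assms(2) and nonsingular = assms(3)
  have C1: "condition_C1 R" using assms(4) by (simp add: right_quasi_continuous_def)
  have central: "f \<otimes>\<^bsub>R\<^esub> r = r \<otimes>\<^bsub>R\<^esub> f" if "idempotent_element R f" "r \<in> carrier R" for f r
    using abelian that unfolding abelian_idempotent_ring_def by blast
  show ?thesis
    unfolding uniquely_special_almost_clean_def
  proof
    fix a assume a: "a \<in> carrier R"
    obtain e where e: "idempotent_element R e" and ae: "a \<otimes>\<^bsub>R\<^esub> e = \<zero>\<^bsub>R\<^esub>"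
      and ann: "\<And>x. x \<in> carrier R \<Longrightarrow> a \<otimes>\<^bsub>R\<^esub> x = \<zero>\<^bsub>R\<^esub> \<Longrightarrow> e \<otimes>\<^bsub>R\<^esub> x = x"
      using right_annihilator_generated_by_idempotent[OF abelian nonsingular C1 a] by blast
    have "regular_element R (a \<ominus>\<^bsub>R\<^esub> e)"
      using left_annihilated_imp_right_annihilated[OF abelian nonsingular C1 a] ann
      by (intro regular_element_diff_idempotent[OF e central[OF e] a ae]) blast+
    then have "(a \<ominus>\<^bsub>R\<^esub> e, e) \<in> special_almost_clean_decompositions R a"
      using special_almost_clean_decomposition_diff_idempotent[OF e central[OF e] a ae] by blast
    moreover have "d = (a \<ominus>\<^bsub>R\<^esub> e, e)" if d: "d \<in> special_almost_clean_decompositions R a" for d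
    proof (cases d)
      case (Pair v f)
      then have "idempotent_element R f"
        using d by (simp add: special_almost_clean_decompositions_def)
      then show ?thesis
        using special_almost_clean_decomposition_unique[OF e central[OF e] a ae ann central] d Pair
        by blast
    qed
    ultimately show "\<exists>!d. d \<in> special_almost_clean_decompositions R a" by blast
  qed
qed

end
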